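(* Let $\alpha$ be a real number with simple continued fraction coefficients $a_0,a_1,a_2,\dots$ and let $h_n,k_n$ ($n\ge -2$) be the numerators and denominators of its convergents. If $\alpha$ is irrational, then $$\text{(a)}\quad \sum_{n=-1}^{\infty}a_{n+1}|h_n-\alpha k_n|=\alpha+1,\qquad \text{(b)}\quad \sum_{n=-1}^{\infty}a_{n+1}(h_n-\alpha k_n)^2=\alpha .$$ If $\alpha=p/q=h_N/k_N$ is rational with $\gcd(p,q)=1$ (so $\alpha=[a_0,a_1,\dots,a_N]$), then $$\text{(c)}\quad \sum_{n=-1}^{N-1}a_{n+1}|h_n-\alpha k_n|=\alpha+1-\frac1q,\qquad \text{(d)}\quad \sum_{n=-1}^{N-1}a_{n+1}(h_n-\alpha k_n)^2=\alpha .$$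
   Context: The simple continued fraction is $\alpha=[a_0,a_1,\dots]=a_0+\cfrac{1}{a_1+\cfrac{1}{a_2+\cdots}}$ with $a_0\in\mathbb{Z}$ and $a_n\in\mathbb{Z}_{>0}$ for $n\ge1$ (finite, $[a_0,\dots,a_N]$, when $\alpha$ is rational). The sequences $h_n,k_n$ are defined by $h_{-2}=0$, $h_{-1}=1$, $h_n=a_nh_{n-1}+h_{n-2}$ and $k_{-2}=1$, $k_{-1}=0$, $k_n=a_nk_{n-1}+k_{n-2}$ for $n\ge 0$, so that $[a_0,\dots,a_n]=h_n/k_n$. In the rational case $q>0$. *)

theory Defs
  imports Complex_Main
begin

(* cf_value a n is the finite continued fraction [a 0, ..., a n]. *)
fun cf_value :: "(nat \<Rightarrow> int) \<Rightarrow> nat \<Rightarrow> real" where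
  "cf_value a 0 = of_int (a 0)"
| "cf_value a (Suc n) = of_int (a 0) + 1 / cf_value (\<lambda>i. a (Suc i)) n"

definition infinite_simple_cf :: "real \<Rightarrow> (nat \<Rightarrow> int) \<Rightarrow> bool" where
  "infinite_simple_cf \<alpha> a \<longleftrightarrow>
     (\<forall>n\<ge>1. a n > 0) \<and> (\<lambda>n. cf_value a n) \<longlonglongrightarrow> \<alpha>"

(* Only a 0, ..., a N matter. No condition a N > 1 is imposed, so both finite
   expansions of a rational number are covered. *)
definition finite_simple_cf :: "real \<Rightarrow> (nat \<Rightarrow> int) \<Rightarrow> nat \<Rightarrow> bool" where
  "finite_simple_cf \<alpha> a N \<longleftrightarrow>
     (\<forall>n. 1 \<le> n \<and> n \<le> N \<longrightarrow> a n > 0) \<and> \<alpha> = cf_value a N"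

(* The index of cf_num and cf_den is an integer because the recursions start at -2;
   the value 0 resp. 1 for indices below -2 is junk. *)
function cf_num :: "(nat \<Rightarrow> int) \<Rightarrow> int \<Rightarrow> int" where
  "cf_num a n =
     (if n \<le> -2 then 0 else if n = -1 then 1
      else a (nat n) * cf_num a (n - 1) + cf_num a (n - 2))"
  by pat_completeness auto
termination by (relation "measure (\<lambda>(a, n). nat (n + 2))") auto

function cf_den :: "(nat \<Rightarrow> int) \<Rightarrow> int \<Rightarrow> int" where
  "cf_den a n =
     (if n \<le> -2 then 1 else if n = -1 then 0
      else a (nat n) * cf_den a (n - 1) + cf_den a (n - 2))"
  by pat_completeness auto
termination by (relation "measure (\<lambda>(a, n). nat (n + 2))") auto

declare cf_num.simps [simp del] cf_den.simps [simp del]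

lemma cf_num_rec:
  "cf_num a (-2) = 0" "cf_num a (-1) = 1"
  "n \<ge> 0 \<Longrightarrow> cf_num a n = a (nat n) * cf_num a (n - 1) + cf_num a (n - 2)"
  by (subst cf_num.simps; simp)+

lemma cf_den_rec:
  "cf_den a (-2) = 1" "cf_den a (-1) = 0"
  "n \<ge> 0 \<Longrightarrow> cf_den a n = a (nat n) * cf_den a (n - 1) + cf_den a (n - 2)"
  by (subst cf_den.simps; simp)+


end

theory Submission imports Defs begin

text \<open>
  The signed errors $e_m = (-1)^m (h_{m-1} - \alpha k_{m-1})$ satisfy
  $e_{m+2} = e_m - a_{m+1} e_{m+1}$, so $\sum a_m e_m$ and $\sum a_m e_m^2$ telescope, with
  remainders $e_M + e_{M+1}$ and $e_M e_{M+1}$. Passing from $\alpha$ to its tail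
  $1/(\alpha - a_0)$ multiplies the errors by a positive factor, hence $e_m \ge 0$.
  In the infinite case $e_m \ge e_{m+1} + e_{m+2}$ then forces $e_m \to 0$; in the finite case
  $e_{N+1} = 0$, and the determinant identity gives $e_N = 1/q$.
\<close>

text \<open>The shift by one pairs \<open>a m\<close> with the error of index m - 1, so the sums
  from n = -1 in the theorem become sums from m = 0.\<close>

definition cf_err :: "(nat \<Rightarrow> int) \<Rightarrow> real \<Rightarrow> nat \<Rightarrow> real" where
  "cf_err a \<alpha> m = (-1) ^ m * (of_int (cf_num a (int m - 1)) - \<alpha> * of_int (cf_den a (int m - 1)))"

section \<open>Recurrences for numerators, denominators and signed errors at natural indices\<close>

lemma cf_num_0: "cf_num a 0 = a 0"
  using cf_num_rec(3)[of 0 a] cf_num_rec(1,2)[of a] by simp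

lemma cf_den_0: "cf_den a 0 = 1"
  using cf_den_rec(3)[of 0 a] cf_den_rec(1,2)[of a] by simp

lemma cf_num_Suc: "cf_num a (int (Suc m)) = a (Suc m) * cf_num a (int m) + cf_num a (int m - 1)"
  using cf_num_rec(3)[of "int (Suc m)" a] by (simp add: nat_add_distrib)

lemma cf_den_Suc: "cf_den a (int (Suc m)) = a (Suc m) * cf_den a (int m) + cf_den a (int m - 1)"
  using cf_den_rec(3)[of "int (Suc m)" a] by (simp add: nat_add_distrib)

lemma cf_err_0: "cf_err a \<alpha> 0 = 1"
  by (simp add: cf_err_def cf_num_rec cf_den_rec)

lemma cf_err_1: "cf_err a \<alpha> (Suc 0) = \<alpha> - of_int (a 0)"
  by (simp add: cf_err_def cf_num_0 cf_den_0)

lemma cf_err_Suc_Suc: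
  "cf_err a \<alpha> (Suc (Suc m)) = cf_err a \<alpha> m - of_int (a (Suc m)) * cf_err a \<alpha> (Suc m)"
proof -
  have "int (Suc (Suc m)) - 1 = int (Suc m)" "int (Suc m) - 1 = int m" by simp_all
  then show ?thesis
    unfolding cf_err_def by (simp only: cf_num_Suc cf_den_Suc) (simp add: algebra_simps)
qed

section \<open>Telescoping of the partial sums\<close>

lemma sum_cf_err:
  "(\<Sum>m<Suc M. of_int (a m) * cf_err a \<alpha> m) = \<alpha> + 1 - cf_err a \<alpha> M - cf_err a \<alpha> (Suc M)"
proof (induction M)
  case 0
  show ?case by (simp add: cf_err_0 cf_err_1)
next
  case (Suc M)
  \<comment> \<open>The new summand equals e_M - e_{M+2}, which turns the remainder e_M + e_{M+1}
    into e_{M+1} + e_{M+2}.\<close>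
  then show ?case by (simp add: cf_err_Suc_Suc)
qed

lemma sum_cf_err_square:
  "(\<Sum>m<Suc M. of_int (a m) * (cf_err a \<alpha> m)\<^sup>2) = \<alpha> - cf_err a \<alpha> M * cf_err a \<alpha> (Suc M)"
proof (induction M)
  case 0
  show ?case by (simp add: cf_err_0 cf_err_1)
next
  case (Suc M)
  \<comment> \<open>The new summand equals e_{M+1} (e_M - e_{M+2}), the difference of consecutive
    remainders.\<close>
  then show ?case by (simp add: cf_err_Suc_Suc power2_eq_square algebra_simps)
qed

section \<open>Nonnegativity of the signed errors\<close>

lemma cf_err_tail:
  assumes "\<alpha> \<noteq> of_int (a 0)"
  shows "cf_err a \<alpha> (Suc m)
    = (\<alpha> - of_int (a 0)) * cf_err (\<lambda>i. a (Suc i)) (1 / (\<alpha> - of_int (a 0))) m"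
\<comment> \<open>Both sides obey the same second-order recurrence in m, with coefficient
  \<open>a (Suc (Suc m))\<close>, so agreement at m = 0 and m = 1 suffices.\<close>
proof (induction m rule: induct_nat_012)
  case 0
  show ?case by (simp add: cf_err_0 cf_err_1)
next
  case 1
  show ?case using assms
    by (simp add: cf_err_Suc_Suc cf_err_0 cf_err_1 field_simps)
next
  case (ge2 m)
  have "cf_err a \<alpha> (Suc (Suc (Suc m)))
      = cf_err a \<alpha> (Suc m) - of_int (a (Suc (Suc m))) * cf_err a \<alpha> (Suc (Suc m))"
    by (rule cf_err_Suc_Suc)
  also have "\<dots> = (\<alpha> - of_int (a 0)) * cf_err (\<lambda>i. a (Suc i)) (1 / (\<alpha> - of_int (a 0))) (Suc (Suc m))"
    unfolding ge2 cf_err_Suc_Suc[of "\<lambda>i. a (Suc i)"] by (simp add: algebra_simps)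
  finally show ?case .
qed

lemma cf_value_pos:
  assumes "\<And>n. n \<le> N \<Longrightarrow> a n > 0"
  shows "cf_value a N > 0"
  using assms
proof (induction N arbitrary: a)
  case 0
  then show ?case by simp
next
  case (Suc N)
  have "cf_value (\<lambda>i. a (Suc i)) N > 0" using Suc by simp
  moreover have "a 0 > 0" using Suc.prems by simp
  ultimately show ?case by (simp add: add_pos_pos)
qed

text \<open>Induction on the length, over all sequences: dropping \<open>a 0\<close> scales the
  errors by the reciprocal of the tail's value, which is positive. For length 0 the errors are 1 and
  0.\<close>

lemma cf_err_cf_value:
  assumes "\<And>n. 1 \<le> n \<Longrightarrow> n \<le> N \<Longrightarrow> a n > 0"
  shows cf_err_cf_value_nonneg: "m \<le> Suc N \<Longrightarrow> cf_err a (cf_value a N) m \<ge> 0"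
    and cf_err_cf_value_last: "cf_err a (cf_value a N) (Suc N) = 0"
proof -
  have "(\<forall>m\<le>Suc N. cf_err a (cf_value a N) m \<ge> 0) \<and> cf_err a (cf_value a N) (Suc N) = 0"
    using assms
  proof (induction N arbitrary: a)
    case 0
    then show ?case by (auto simp: le_Suc_eq cf_err_0 cf_err_1)
  next
    case (Suc N)
    let ?b = "\<lambda>i. a (Suc i)"
    have pos: "cf_value ?b N > 0" using Suc.prems by (intro cf_value_pos) simp
    have IH: "(\<forall>m\<le>Suc N. cf_err ?b (cf_value ?b N) m \<ge> 0) \<and> cf_err ?b (cf_value ?b N) (Suc N) = 0"
      using Suc.prems by (intro Suc.IH) simp
    have tail: "cf_err a (cf_value a (Suc N)) (Suc m) = cf_err ?b (cf_value ?b N) m / cf_value ?b N" for m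
      using pos cf_err_tail[of "cf_value a (Suc N)" a m] by simp
    have "cf_err a (cf_value a (Suc N)) m \<ge> 0" if "m \<le> Suc (Suc N)" for m
    proof (cases m)
      case 0
      then show ?thesis by (simp add: cf_err_0)
    next
      case (Suc k)
      then show ?thesis using that IH pos by (simp only: tail) simp
    qed
    moreover have "cf_err a (cf_value a (Suc N)) (Suc (Suc N)) = 0"
      using IH unfolding tail by simp
    ultimately show ?case by blast
  qed
  then show "m \<le> Suc N \<Longrightarrow> cf_err a (cf_value a N) m \<ge> 0"
    and "cf_err a (cf_value a N) (Suc N) = 0" by blast+
qed

text \<open>For fixed m the error is affine in \<alpha>, hence continuous, so its sign at the finite
  truncations passes to the limit. Truncations with n \<ge> m are long enough for the finite result
  to cover index m.\<close>

lemma cf_err_nonneg_infinite: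
  assumes "infinite_simple_cf \<alpha> a"
  shows "cf_err a \<alpha> m \<ge> 0"
proof (rule tendsto_lowerbound)
  have "(\<lambda>n. cf_value a n) \<longlonglongrightarrow> \<alpha>" using assms by (simp add: infinite_simple_cf_def)
  then show "(\<lambda>n. cf_err a (cf_value a n) m) \<longlonglongrightarrow> cf_err a \<alpha> m"
    unfolding cf_err_def by (intro tendsto_intros)
  show "\<forall>\<^sub>F n in sequentially. 0 \<le> cf_err a (cf_value a n) m"
    using eventually_ge_at_top[of m]
    by eventually_elim (use assms in \<open>auto simp: infinite_simple_cf_def intro!: cf_err_cf_value_nonneg\<close>)
qed simp

section \<open>Convergence of the errors to 0\<close>

lemma cf_err_tendsto_0:
  assumes "infinite_simple_cf \<alpha> a"
  shows "cf_err a \<alpha> \<longlonglongrightarrow> 0"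
proof -
  let ?e = "cf_err a \<alpha>"
  have nonneg: "?e m \<ge> 0" for m using assms by (rule cf_err_nonneg_infinite)
  have step: "?e (Suc m) + ?e (Suc (Suc m)) \<le> ?e m" for m
  proof -
    \<comment> \<open>Positivity of an integer gives at least 1, and e_m = a_{m+1} e_{m+1} +
      e_{m+2}.\<close>
    have "a (Suc m) \<ge> 1" using assms by (simp add: infinite_simple_cf_def int_one_le_iff_zero_less)
    then have "1 * ?e (Suc m) \<le> of_int (a (Suc m)) * ?e (Suc m)"
      by (intro mult_right_mono nonneg) simp
    then show ?thesis by (simp add: cf_err_Suc_Suc)
  qed
  have "decseq ?e"
    unfolding decseq_Suc_iff using step nonneg by (smt (verit))
  then obtain L where L: "?e \<longlonglongrightarrow> L"
    using decseq_convergent[of ?e 0] nonneg by blast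
  have L1: "(\<lambda>m. ?e (Suc m)) \<longlonglongrightarrow> L" using L by (rule LIMSEQ_Suc)
  \<comment> \<open>The limit exists by monotonicity; letting m tend to infinity in
    \<open>step\<close> gives 2L \<le> L, which with L \<ge> 0 leaves only L = 0.\<close>
  have "L + L \<le> L"
    using LIMSEQ_le[OF tendsto_add[OF L1 LIMSEQ_Suc[OF L1]] L] step by blast
  moreover have "L \<ge> 0" using L nonneg by (intro LIMSEQ_le_const) auto
  ultimately show ?thesis using L by simp
qed

section \<open>Expressing the summands of the theorem by signed errors\<close>

lemma cf_err_square:
  "(of_int (cf_num a (int m - 1)) - \<alpha> * of_int (cf_den a (int m - 1)))\<^sup>2 = (cf_err a \<alpha> m)\<^sup>2"
  by (simp add: cf_err_def power_mult_distrib flip: power_mult)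

lemma cf_err_abs:
  assumes "cf_err a \<alpha> m \<ge> 0"
  shows "\<bar>of_int (cf_num a (int m - 1)) - \<alpha> * of_int (cf_den a (int m - 1))\<bar> = cf_err a \<alpha> m"
proof -
  have "\<bar>cf_err a \<alpha> m\<bar> = \<bar>of_int (cf_num a (int m - 1)) - \<alpha> * of_int (cf_den a (int m - 1))\<bar>"
    by (simp add: cf_err_def abs_mult power_abs)
  then show ?thesis using assms by simp
qed

section \<open>The determinant identity and the last nonzero error of a rational number\<close>

lemma cf_determinant:
  "cf_num a (int m) * cf_den a (int m - 1) - cf_num a (int m - 1) * cf_den a (int m) = (-1) ^ Suc m"
proof (induction m)
  case 0
  show ?case by (simp add: cf_num_0 cf_den_0 cf_num_rec cf_den_rec)
next
  case (Suc m)
  have "int (Suc m) - 1 = int m" by simp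
  then show ?case using Suc by (simp only: cf_num_Suc cf_den_Suc) (simp add: algebra_simps)
qed

lemma cf_den_pos:
  assumes "\<And>n. 1 \<le> n \<Longrightarrow> n \<le> N \<Longrightarrow> a n > 0"
  shows "cf_den a (int N) > 0"
proof -
  \<comment> \<open>The recurrence reaches two steps back, so the previous denominator is carried
    along; it is only nonnegative since k_{-1} = 0.\<close>
  have "cf_den a (int N) > 0 \<and> cf_den a (int N - 1) \<ge> 0"
    using assms
  proof (induction N)
    case 0
    show ?case by (simp add: cf_den_0 cf_den_rec)
  next
    case (Suc N)
    have "int (Suc N) - 1 = int N" by simp
    moreover have "cf_den a (int N) > 0 \<and> cf_den a (int N - 1) \<ge> 0" "a (Suc N) > 0"
      using Suc by simp_all
    ultimately show ?case by (simp only: cf_den_Suc) (simp add: add_pos_nonneg)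
  qed
  then show ?thesis ..
qed

text \<open>The fractions h_N/k_N and p/q are equal, both reduced and with positive denominators, so
  k_N = q. It remains to show e_N k_N = 1.\<close>

lemma cf_err_finite_last:
  fixes p q :: int
  assumes pos: "\<And>n. 1 \<le> n \<Longrightarrow> n \<le> N \<Longrightarrow> a n > 0"
    and "q > 0" "coprime p q" and pq: "cf_value a N = of_int p / of_int q"
  shows "cf_err a (cf_value a N) N = 1 / of_int q"
proof -
  let ?h = "cf_num a (int N)" and ?k = "cf_den a (int N)"
  have k: "?k > 0" using pos by (rule cf_den_pos)
  have hk: "of_int ?h = cf_value a N * of_int ?k"
    using cf_err_cf_value_last[OF pos] by (simp add: cf_err_def)
  then have "real_of_int (?h * q) = real_of_int (p * ?k)"
    using \<open>q > 0\<close> by (simp add: pq field_simps)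
  then have cross: "?h * q = p * ?k" by linarith
  have "coprime ?h ?k"
  proof (rule coprimeI)
    fix c assume "c dvd ?h" "c dvd ?k"
    \<comment> \<open>A common divisor of h_N and k_N divides the determinant, which is a
      unit.\<close>
    then have "c dvd (-1) ^ Suc N" unfolding cf_determinant[of a N, symmetric] by simp
    then show "is_unit c" by (rule dvd_unit_imp_unit) simp
  qed
  have "?k dvd q"
    using cross \<open>coprime ?h ?k\<close> by (metis coprime_commute coprime_dvd_mult_right_iff dvd_triv_right)
  moreover have "q dvd ?k"
    using cross \<open>coprime p q\<close> by (metis coprime_commute coprime_dvd_mult_right_iff dvd_triv_right)
  ultimately have kq: "?k = q" using k \<open>q > 0\<close> by (simp add: zdvd_antisym_nonneg)
  \<comment> \<open>Multiplying by k_N and using \<alpha> k_N = h_N makes the determinant appear, up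
    to a sign that cancels against \<open>(-1) ^ N\<close>.\<close>
  have "cf_err a (cf_value a N) N * of_int ?k
      = (-1) ^ N * (of_int (cf_num a (int N - 1)) * of_int ?k - of_int ?h * of_int (cf_den a (int N - 1)))"
    unfolding cf_err_def hk by (simp add: algebra_simps)
  also have "\<dots> = (-1) ^ N * of_int (- (?h * cf_den a (int N - 1) - cf_num a (int N - 1) * ?k))"
    by simp
  also have "\<dots> = 1" unfolding cf_determinant by (simp flip: power_mult_distrib)
  finally show ?thesis using kq \<open>q > 0\<close> by (simp add: field_simps)
qed

section \<open>Evaluation of the infinite and finite sums\<close>

lemma sum_int_from_minus_one:
  fixes f :: "int \<Rightarrow> 'a::comm_monoid_add"
  shows "(\<Sum>n = -1..int N - 1. f n) = (\<Sum>m<Suc N. f (int m - 1))"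
  by (rule sum.reindex_bij_witness[of _ "\<lambda>m. int m - 1" "\<lambda>n. nat (n + 1)"]) auto

lemma infinite_cf_err_sums:
  assumes "infinite_simple_cf \<alpha> a"
  shows "(\<lambda>m. of_int (a m) * cf_err a \<alpha> m) sums (\<alpha> + 1)"
    and "(\<lambda>m. of_int (a m) * (cf_err a \<alpha> m)\<^sup>2) sums \<alpha>"
proof -
  note lim = cf_err_tendsto_0[OF assms]
  note lims = lim LIMSEQ_Suc[OF lim]
  have "(\<lambda>M. \<alpha> + 1 - cf_err a \<alpha> M - cf_err a \<alpha> (Suc M)) \<longlonglongrightarrow> \<alpha> + 1 - 0 - 0"
    by (intro tendsto_intros lims)
  then show "(\<lambda>m. of_int (a m) * cf_err a \<alpha> m) sums (\<alpha> + 1)"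
    \<comment> \<open>The telescoped formula is for \<open>Suc M\<close> summands, so the sequence
      of partial sums is shifted by one.\<close>
    unfolding sums_def sum_cf_err[symmetric] by (subst filterlim_sequentially_Suc[symmetric]) simp
  have "(\<lambda>M. \<alpha> - cf_err a \<alpha> M * cf_err a \<alpha> (Suc M)) \<longlonglongrightarrow> \<alpha> - 0 * 0"
    by (intro tendsto_intros lims)
  then show "(\<lambda>m. of_int (a m) * (cf_err a \<alpha> m)\<^sup>2) sums \<alpha>"
    unfolding sums_def sum_cf_err_square[symmetric] by (subst filterlim_sequentially_Suc[symmetric]) simp
qed

theorem theorem4:
  fixes \<alpha> :: real and a :: "nat \<Rightarrow> int"
  shows "(\<alpha> \<notin> \<rat> \<and> infinite_simple_cf \<alpha> a \<longrightarrow>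
      (\<lambda>m. of_int (a m) * \<bar>of_int (cf_num a (int m - 1)) - \<alpha> * of_int (cf_den a (int m - 1))\<bar>)
        sums (\<alpha> + 1) \<and>
      (\<lambda>m. of_int (a m) * (of_int (cf_num a (int m - 1)) - \<alpha> * of_int (cf_den a (int m - 1)))\<^sup>2)
        sums \<alpha>) \<and>
    (\<forall>(p::int) (q::int) (N::nat).
      q > 0 \<and> coprime p q \<and> \<alpha> = of_int p / of_int q \<and> finite_simple_cf \<alpha> a N \<longrightarrow>
      (\<Sum>n = -1..int N - 1. of_int (a (nat (n + 1))) * \<bar>of_int (cf_num a n) - \<alpha> * of_int (cf_den a n)\<bar>)
        = \<alpha> + 1 - 1 / of_int q \<and>
      (\<Sum>n = -1..int N - 1. of_int (a (nat (n + 1))) * (of_int (cf_num a n) - \<alpha> * of_int (cf_den a n))\<^sup>2)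
        = \<alpha>)"
proof (intro conjI impI allI; (elim conjE)?)
  assume "infinite_simple_cf \<alpha> a"
  note inf = this
  show "(\<lambda>m. of_int (a m) * \<bar>of_int (cf_num a (int m - 1)) - \<alpha> * of_int (cf_den a (int m - 1))\<bar>)
        sums (\<alpha> + 1)"
    unfolding cf_err_abs[OF cf_err_nonneg_infinite[OF inf]] by (rule infinite_cf_err_sums[OF inf])
  show "(\<lambda>m. of_int (a m) * (of_int (cf_num a (int m - 1)) - \<alpha> * of_int (cf_den a (int m - 1)))\<^sup>2)
        sums \<alpha>"
    unfolding cf_err_square by (rule infinite_cf_err_sums[OF inf])
next
  fix p q :: int and N :: nat
  assume q: "q > 0" "coprime p q" and pq: "\<alpha> = of_int p / of_int q" and fin: "finite_simple_cf \<alpha> a N"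
  have pos: "a n > 0" if "1 \<le> n" "n \<le> N" for n
    using fin that by (simp add: finite_simple_cf_def)
  have \<alpha>: "\<alpha> = cf_value a N" using fin by (simp add: finite_simple_cf_def)
  have zero: "cf_err a \<alpha> (Suc N) = 0" unfolding \<alpha> using pos by (rule cf_err_cf_value_last)
  have last: "cf_err a \<alpha> N = 1 / of_int q"
    using cf_err_finite_last[OF pos q] pq unfolding \<alpha> by simp
  have nonneg: "cf_err a \<alpha> m \<ge> 0" if "m < Suc N" for m
    unfolding \<alpha> using that by (intro cf_err_cf_value_nonneg pos) auto
  have "(\<Sum>n = -1..int N - 1. of_int (a (nat (n + 1))) * \<bar>of_int (cf_num a n) - \<alpha> * of_int (cf_den a n)\<bar>)
      = (\<Sum>m<Suc N. of_int (a m) * cf_err a \<alpha> m)"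
    unfolding sum_int_from_minus_one by (rule sum.cong) (simp_all add: cf_err_abs nonneg)
  then show "(\<Sum>n = -1..int N - 1. of_int (a (nat (n + 1))) * \<bar>of_int (cf_num a n) - \<alpha> * of_int (cf_den a n)\<bar>)
      = \<alpha> + 1 - 1 / of_int q"
    \<comment> \<open>The remainder is e_N + e_{N+1} = 1/q + 0; for the squares below it is e_N
      e_{N+1} = 0.\<close>
    unfolding sum_cf_err zero last by simp
  have "(\<Sum>n = -1..int N - 1. of_int (a (nat (n + 1))) * (of_int (cf_num a n) - \<alpha> * of_int (cf_den a n))\<^sup>2)
      = (\<Sum>m<Suc N. of_int (a m) * (cf_err a \<alpha> m)\<^sup>2)"
    unfolding sum_int_from_minus_one cf_err_square by simp
  then show "(\<Sum>n = -1..int N - 1. of_int (a (nat (n + 1))) * (of_int (cf_num a n) - \<alpha> * of_int (cf_den a n))\<^sup>2)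
      = \<alpha>"
    unfolding sum_cf_err_square zero by simp
qed

end
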